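(* For any positive integer $j$ and for any graph $G=(V,E)$, $$c_j(G) \leq \alpha_j(G) \leq a_j(G),$$ where $\alpha_j(G)$ is the $j$-independence number, $a_j(G)$ is the upper $j$-annihilation number and $c_j(G)$ is the lower $j$-annihilation number of $G$.
   Context: All graphs are simple and finite. For $G=(V,E)$, $n=n(G)=|V|$, $m(G)=|E|$, and $d_1\le d_2\le\dots\le d_n$ is the degree sequence of $G$ in non-decreasing order. For $S\subseteq V$, $[S]$ is the induced subgraph on $S$ and $m[S]$ is its number of edges. A $j$-independent set is a set $I\subseteq V$ such that the maximum degree of $[I]$ satisfies $\Delta([I])<j$; $\alpha_j(G)$ is the cardinality of a largest $j$-independent set. Let $F$ be the family of all maximum (i.e. largest-cardinality) $j$-independent sets of $G$. Define (with $k$ ranging over integers $0\le k\le n$) $$a_j(G)=\max\Big\{k : \sum_{i=1}^k d_i+\max_{S\in F}\{m[V-S]-m[S]\}\le m(G)\Big\},$$ $$c_j(G)=\min\Big\{k : \sum_{i=1}^k d_{n-i+1}+\min_{S\in F}\{m[V-S]-m[S]\}\ge m(G)\Big\}.$$ *)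

theory Defs
  imports Main "HOL-Library.Multiset"
begin

definition simple_graph :: "'a set \<Rightarrow> 'a set set \<Rightarrow> bool" where
  "simple_graph V E \<longleftrightarrow> finite V \<and> (\<forall>e\<in>E. e \<subseteq> V \<and> card e = 2)"

definition vertex_degree :: "'a set set \<Rightarrow> 'a \<Rightarrow> nat" where
  "vertex_degree E v = card {e \<in> E. v \<in> e}"

definition induced_edges :: "'a set set \<Rightarrow> 'a set \<Rightarrow> 'a set set" where
  "induced_edges E S = {e \<in> E. e \<subseteq> S}"

(* Inserting 0 does not affect graphs with a vertex; it fixes the maximum degree
   of the graph without vertices to be 0, so the empty set is j-independent for j > 0. *)
definition max_degree :: "'a set \<Rightarrow> 'a set set \<Rightarrow> nat" where
  "max_degree V E = Max (insert 0 (vertex_degree E ` V))"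

definition j_independent :: "'a set \<Rightarrow> 'a set set \<Rightarrow> nat \<Rightarrow> 'a set \<Rightarrow> bool" where
  "j_independent V E j I \<longleftrightarrow> I \<subseteq> V \<and> max_degree I (induced_edges E I) < j"

definition j_independence_number :: "'a set \<Rightarrow> 'a set set \<Rightarrow> nat \<Rightarrow> nat" where
  "j_independence_number V E j = Max (card ` {I. j_independent V E j I})"

definition max_j_independent_sets :: "'a set \<Rightarrow> 'a set set \<Rightarrow> nat \<Rightarrow> 'a set set" where
  "max_j_independent_sets V E j =
     {S. j_independent V E j S \<and> card S = j_independence_number V E j}"

(* degree_seq V E i is the i-th smallest degree, counted with multiplicity.  Indices run
   from 1 to card V; values at other indices carry no meaning. *)
definition degree_seq :: "'a set \<Rightarrow> 'a set set \<Rightarrow> nat \<Rightarrow> nat" where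
  "degree_seq V E i =
     sorted_list_of_multiset (image_mset (vertex_degree E) (mset_set V)) ! (i - 1)"

(* The difference m[V - S] - m[S] can be negative. *)
definition edge_diff :: "'a set \<Rightarrow> 'a set set \<Rightarrow> 'a set \<Rightarrow> int" where
  "edge_diff V E S = int (card (induced_edges E (V - S))) - int (card (induced_edges E S))"

definition upper_annihilation_number :: "'a set \<Rightarrow> 'a set set \<Rightarrow> nat \<Rightarrow> nat" where
  "upper_annihilation_number V E j =
     Max {k. k \<le> card V \<and>
            int (\<Sum>i = 1..k. degree_seq V E i)
              + Max (edge_diff V E ` max_j_independent_sets V E j) \<le> int (card E)}"

definition lower_annihilation_number :: "'a set \<Rightarrow> 'a set set \<Rightarrow> nat \<Rightarrow> nat" where
  "lower_annihilation_number V E j =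
     Min {k. k \<le> card V \<and>
            int (\<Sum>i = 1..k. degree_seq V E (card V - i + 1))
              + Min (edge_diff V E ` max_j_independent_sets V E j) \<ge> int (card E)}"

end

theory Submission
  imports Defs
begin

text \<open>
  Both bounds come from one identity: every \<open>S \<subseteq> V\<close> satisfies
  \<open>(\<Sum>v\<in>S. deg v) + (m[V - S] - m[S]) = m(G)\<close>, because an edge with \<open>2\<close>, \<open>1\<close> or \<open>0\<close> ends in \<open>S\<close>
  contributes \<open>2 - 1\<close>, \<open>1\<close> or \<open>0 + 1\<close> to the left-hand side
  (\<open>degree_sum_plus_edge_diff\<close>).

  Let \<open>k\<close> be the \<open>j\<close>-independence number and let \<open>S\<close> be a maximum \<open>j\<close>-independent set, so that
  \<open>card S = k\<close>.  The degree sum over \<open>S\<close> lies between the sum of the \<open>k\<close> smallest and the sum of the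
  \<open>k\<close> largest degrees (\<open>smallest_degrees_le\<close>, \<open>le_largest_degrees\<close>).  For an \<open>S\<close> that
  maximizes the difference \<open>m[V - S] - m[S]\<close>, the identity therefore says that \<open>k\<close> meets the condition
  in the definition of the upper annihilation number, which is the largest such value; for an
  \<open>S\<close> that minimizes the difference, \<open>k\<close> meets the condition defining the lower one, which is the
  smallest such value.
\<close>

text \<open>
  In the inductive step, an entry \<open>x\<close> that is missing from \<open>M\<close> is exchanged for the next one: the
  prefix of \<open>x # xs\<close> has a sum no larger than the prefix of \<open>xs\<close> of the same length, since \<open>x\<close> is
  the smallest entry.
\<close>

lemma sum_list_take_le_sum_mset:
  fixes xs :: "nat list"
  assumes "sorted xs" and "M \<subseteq># mset xs"
  shows "sum_list (take (size M) xs) \<le> sum_mset M"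
  using assms
proof (induction xs arbitrary: M)
  case Nil
  then show ?case by simp
next
  case (Cons x xs)
  show ?case
  proof (cases "x \<in># M")
    case True
    then obtain N where M: "M = add_mset x N"
      by (blast dest: multi_member_split)
    with Cons have "sum_list (take (size N) xs) \<le> sum_mset N"
      by simp
    with M show ?thesis by simp
  next
    case False
    with Cons.prems have sub: "M \<subseteq># mset xs"
      by (metis diff_single_trivial mset.simps(2) subset_eq_diff_conv add_mset_add_single)
    with Cons have IH: "sum_list (take (size M) xs) \<le> sum_mset M"
      by simp
    have "sum_list (take (size M) (x # xs)) \<le> sum_list (take (size M) xs)"
    proof (cases "size M")
      case 0
      then show ?thesis by simp
    next
      case (Suc k)
      with sub have k: "k < length xs"
        by (metis Suc_le_eq size_mset size_mset_mono)
      with Cons.prems(1) have "x \<le> xs ! k" by simp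
      with k Suc show ?thesis by (simp add: take_Suc_conv_app_nth)
    qed
    with IH show ?thesis by simp
  qed
qed

text \<open>The lower bound for the complement \<open>mset xs - M\<close>, subtracted from the total sum.\<close>

lemma sum_mset_le_sum_list_drop:
  fixes xs :: "nat list"
  assumes "sorted xs" and "M \<subseteq># mset xs"
  shows "sum_mset M \<le> sum_list (drop (length xs - size M) xs)"
proof -
  let ?t = "length xs - size M"
  have "size (mset xs - M) = ?t"
    using assms(2) by (simp add: size_Diff_submset)
  with sum_list_take_le_sum_mset[OF assms(1), of "mset xs - M"]
  have "sum_list (take ?t xs) \<le> sum_mset (mset xs - M)"
    by simp
  moreover have "sum_mset (mset xs - M) + sum_mset M = sum_list xs"
    using assms(2) by (metis subset_mset.diff_add sum_mset.union sum_mset_sum_list)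
  moreover have "sum_list (take ?t xs) + sum_list (drop ?t xs) = sum_list xs"
    by (metis append_take_drop_id sum_list_append)
  ultimately show ?thesis by linarith
qed

lemma sum_nth_eq_sum_list_take:
  fixes xs :: "nat list"
  assumes "k \<le> length xs"
  shows "(\<Sum>i = 1..k. xs ! (i - 1)) = sum_list (take k xs)"
  using assms by (induction k) (simp_all add: take_Suc_conv_app_nth)

lemma sum_nth_rev_eq_sum_list_drop:
  fixes xs :: "nat list"
  assumes "k \<le> length xs"
  shows "(\<Sum>i = 1..k. xs ! (length xs - i)) = sum_list (drop (length xs - k) xs)"
  using assms
proof (induction k)
  case (Suc k)
  then have "drop (length xs - Suc k) xs = xs ! (length xs - Suc k) # drop (length xs - k) xs"
    by (metis Cons_nth_drop_Suc Suc_diff_Suc Suc_le_eq diff_less length_greater_0_conv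
        list.size(3) not_less_zero zero_less_Suc)
  with Suc show ?case by simp
qed simp

lemma image_mset_vertex_degree_mono:
  assumes "finite V" and "S \<subseteq> V"
  shows "image_mset (vertex_degree E) (mset_set S)
    \<subseteq># image_mset (vertex_degree E) (mset_set V)"
  using assms by (simp add: image_mset_subseteq_mono subset_imp_msubset_mset_set)

lemma smallest_degrees_le:
  assumes "finite V" and "S \<subseteq> V"
  shows "(\<Sum>i = 1..card S. degree_seq V E i) \<le> (\<Sum>v\<in>S. vertex_degree E v)"
proof -
  let ?M = "image_mset (vertex_degree E) (mset_set S)"
  let ?xs = "sorted_list_of_multiset (image_mset (vertex_degree E) (mset_set V))"
  have len: "card S \<le> length ?xs"
    using assms by (simp add: card_mono flip: size_mset)
  have "(\<Sum>i = 1..card S. degree_seq V E i) = sum_list (take (card S) ?xs)"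
    unfolding degree_seq_def using len by (rule sum_nth_eq_sum_list_take)
  also have "\<dots> \<le> sum_mset ?M"
    using sum_list_take_le_sum_mset[of ?xs ?M] image_mset_vertex_degree_mono[OF assms]
    by simp
  finally show ?thesis by (simp add: sum_unfold_sum_mset)
qed

lemma le_largest_degrees:
  assumes "finite V" and "S \<subseteq> V"
  shows "(\<Sum>v\<in>S. vertex_degree E v) \<le> (\<Sum>i = 1..card S. degree_seq V E (card V - i + 1))"
proof -
  let ?M = "image_mset (vertex_degree E) (mset_set S)"
  let ?xs = "sorted_list_of_multiset (image_mset (vertex_degree E) (mset_set V))"
  have len: "length ?xs = card V"
    by (simp flip: size_mset)
  have "(\<Sum>v\<in>S. vertex_degree E v) = sum_mset ?M"
    by (simp add: sum_unfold_sum_mset)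
  also have "\<dots> \<le> sum_list (drop (card V - card S) ?xs)"
    using sum_mset_le_sum_list_drop[of ?xs ?M] image_mset_vertex_degree_mono[OF assms] len
    by simp
  also have "\<dots> = (\<Sum>i = 1..card S. degree_seq V E (card V - i + 1))"
    using sum_nth_rev_eq_sum_list_drop[of "card S" ?xs] len assms
    by (simp add: degree_seq_def card_mono)
  finally show ?thesis .
qed

lemma finite_edges:
  assumes "simple_graph V E"
  shows "finite E"
  using assms unfolding simple_graph_def by (meson PowI finite_Pow_iff finite_subset subsetI)

lemma degree_sum_eq_sum_card_Int:
  assumes "finite E" and "finite S"
  shows "(\<Sum>v\<in>S. vertex_degree E v) = (\<Sum>e\<in>E. card (e \<inter> S))"
proof -
  have "(\<Sum>v\<in>S. vertex_degree E v) = (\<Sum>v\<in>S. \<Sum>e\<in>E. if v \<in> e then 1 else 0)"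
    using assms by (simp add: vertex_degree_def flip: sum.inter_filter)
  also have "\<dots> = (\<Sum>e\<in>E. \<Sum>v\<in>S. if v \<in> e then 1 else 0)"
    by (rule sum.swap)
  also have "\<dots> = (\<Sum>e\<in>E. card (e \<inter> S))"
    using assms by (simp add: Int_def conj_commute flip: sum.inter_filter)
  finally show ?thesis .
qed

text \<open>
  The identity is checked edge by edge.  For an edge \<open>e\<close>, the value of \<open>card (e \<inter> S)\<close> decides
  whether \<open>e\<close> lies inside \<open>S\<close>, crosses between \<open>S\<close> and \<open>V - S\<close>, or lies inside \<open>V - S\<close>; its net
  contribution is \<open>1\<close> in each case.
\<close>

lemma degree_sum_plus_edge_diff:
  assumes G: "simple_graph V E" and "S \<subseteq> V"
  shows "int (\<Sum>v\<in>S. vertex_degree E v) + edge_diff V E S = int (card E)"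
proof -
  have finE: "finite E" and finS: "finite S"
    using G assms(2) finite_edges by (auto simp: simple_graph_def intro: finite_subset)
  have count: "int (card (induced_edges E T)) = (\<Sum>e\<in>E. if e \<subseteq> T then 1 else 0)" for T
    using finE by (simp add: induced_edges_def flip: sum.inter_filter)
  have edge: "int (card (e \<inter> S)) + ((if e \<subseteq> V - S then 1 else 0) - (if e \<subseteq> S then 1 else 0)) = 1"
    if "e \<in> E" for e
  proof -
    have "e \<subseteq> V" "card e = 2" using G that by (auto simp: simple_graph_def)
    then obtain x y where "e = {x, y}" "x \<noteq> y" by (auto simp: card_2_iff)
    with \<open>e \<subseteq> V\<close> show ?thesis by (auto simp: Int_insert_left)
  qed
  have "int (\<Sum>v\<in>S. vertex_degree E v) + edge_diff V E S
      = (\<Sum>e\<in>E. int (card (e \<inter> S)) + ((if e \<subseteq> V - S then 1 else 0) - (if e \<subseteq> S then 1 else 0)))"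
    by (simp add: degree_sum_eq_sum_card_Int[OF finE finS] edge_diff_def count
        sum.distrib sum_subtractf)
  also have "\<dots> = (\<Sum>e\<in>E. 1)"
    by (rule sum.cong[OF refl]) (rule edge)
  finally show ?thesis by simp
qed

lemma finite_j_independent:
  assumes "finite V"
  shows "finite {I. j_independent V E j I}"
  by (rule finite_subset[of _ "Pow V"]) (auto simp: j_independent_def assms)

text \<open>
  The empty set is \<open>j\<close>-independent for positive \<open>j\<close>, so the largest cardinality is attained.
\<close>

lemma max_j_independent_sets_nonempty:
  assumes "finite V" and "j > 0"
  shows "max_j_independent_sets V E j \<noteq> {}"
proof -
  have "{} \<in> {I. j_independent V E j I}"
    using assms(2) by (simp add: j_independent_def max_degree_def)
  then have "j_independence_number V E j \<in> card ` {I. j_independent V E j I}"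
    unfolding j_independence_number_def
    by (intro Max_in finite_imageI finite_j_independent assms(1)) blast
  then show ?thesis by (auto simp: max_j_independent_sets_def)
qed

theorem theorem3p4:
  fixes V :: "'a set" and E :: "'a set set" and j :: nat
  assumes "simple_graph V E"
    and "j > 0"
  shows "lower_annihilation_number V E j \<le> j_independence_number V E j
    \<and> j_independence_number V E j \<le> upper_annihilation_number V E j"
proof
  let ?F = "max_j_independent_sets V E j"
  have finV: "finite V" using assms(1) by (simp add: simple_graph_def)
  have "?F \<subseteq> {I. j_independent V E j I}"
    by (auto simp: max_j_independent_sets_def)
  then have fin: "finite (edge_diff V E ` ?F)"
    using finite_j_independent[OF finV] by (blast intro: finite_subset)
  have ne: "edge_diff V E ` ?F \<noteq> {}"
    using max_j_independent_sets_nonempty[OF finV assms(2)] by simp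
  have F: "S \<subseteq> V" "card S = j_independence_number V E j" if "S \<in> ?F" for S
    using that by (auto simp: max_j_independent_sets_def j_independent_def)

  obtain S where S: "S \<in> ?F" "Min (edge_diff V E ` ?F) = edge_diff V E S"
    using Min_in[OF fin ne] by auto
  show "lower_annihilation_number V E j \<le> j_independence_number V E j"
    unfolding lower_annihilation_number_def S(2)
  proof (rule Min_le)
    show "j_independence_number V E j \<in> {k. k \<le> card V \<and>
      int (\<Sum>i = 1..k. degree_seq V E (card V - i + 1)) + edge_diff V E S \<ge> int (card E)}"
      using le_largest_degrees[OF finV F(1)[OF S(1)], of E]
        degree_sum_plus_edge_diff[OF assms(1) F(1)[OF S(1)]]
        card_mono[OF finV F(1)[OF S(1)]]
      unfolding F(2)[OF S(1)] mem_Collect_eq by linarith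
  qed simp

  obtain T where T: "T \<in> ?F" "Max (edge_diff V E ` ?F) = edge_diff V E T"
    using Max_in[OF fin ne] by auto
  show "j_independence_number V E j \<le> upper_annihilation_number V E j"
    unfolding upper_annihilation_number_def T(2)
  proof (rule Max_ge)
    show "j_independence_number V E j \<in> {k. k \<le> card V \<and>
      int (\<Sum>i = 1..k. degree_seq V E i) + edge_diff V E T \<le> int (card E)}"
      using smallest_degrees_le[OF finV F(1)[OF T(1)], of E]
        degree_sum_plus_edge_diff[OF assms(1) F(1)[OF T(1)]]
        card_mono[OF finV F(1)[OF T(1)]]
      unfolding F(2)[OF T(1)] mem_Collect_eq by linarith
  qed simp
qed

end
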